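(* Let $f\colon \mathbb{H}\to\mathbb{H}$ be a parabolic holomorphic map of finite shift with its Denjoy-Wolff point at infinity, and let $\beta\in\mathbb{R}$ and $\mu$ (a positive finite Borel measure on $\mathbb{R}$) be its representing parameters, that is, $$f(z) = z + \beta + \int_{\mathbb{R}}\frac{1+tz}{t-z}\,d\mu(t), \quad z\in\mathbb{H}.$$ Then $$\frac{f^n}{n}\to \beta-\int_{\mathbb{R}}t\,d\mu(t), \quad n\to+\infty,$$ uniformly on compact subsets of $\mathbb{H}$.
   Context: $\mathbb{H}=\{z=x+iy\in\mathbb{C}: y>0\}$ is the upper half-plane, and $f^n$ denotes the $n$-th iterate of $f$ ($f^0=\mathrm{Id}$, $f^{n+1}=f\circ f^n$). A holomorphic map $f\colon\mathbb{H}\to\mathbb{H}$ is non-elliptic if it has no fixed point in $\mathbb{H}$; then $f^n$ converges, uniformly on compact subsets of $\mathbb{H}$, to a point $\tau\in\mathbb{R}\cup\{\infty\}$, called the Denjoy-Wolff point of $f$. If $f$ is non-elliptic with Denjoy-Wolff point $\infty$, the angular (non-tangential) limit $\lambda=\angle\lim_{z\to\infty} f(z)/z$ exists and lies in $[1,+\infty)$; $f$ is called parabolic if $\lambda=1$. Representation (known): a holomorphic $f\colon\mathbb{H}\to\mathbb{H}$ is parabolic with Denjoy-Wolff point at infinity if and only if it can be written as $f(z)=z+\beta+\int_{\mathbb{R}}\frac{1+tz}{t-z}\,d\mu(t)$, $z\in\mathbb{H}$, with $\beta\in\mathbb{R}$ and $\mu$ a positive finite Borel measure on $\mathbb{R}$,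 not both null; the pair $(\beta,\mu)$ is unique. A parabolic $f\colon\mathbb{H}\to\mathbb{H}$ with Denjoy-Wolff point at infinity is of finite shift if there exists $z_0\in\mathbb{H}$ such that the orbit $z_n=x_n+iy_n=f^n(z_0)$ satisfies $\sup_n y_n<+\infty$ (this does not depend on the choice of $z_0$). For $f$ of finite shift one has $\int_{\mathbb{R}}|t|\,d\mu(t)<+\infty$, so $\int_{\mathbb{R}}t\,d\mu(t)$ is a well-defined real number. *)

theory Defs
  imports "HOL-Analysis.Analysis"
begin

definition upper_half_plane :: "complex set" where
  "upper_half_plane = {z. Im z > 0}"

definition holomorphic_self_map :: "(complex \<Rightarrow> complex) \<Rightarrow> bool" where
  "holomorphic_self_map f \<longleftrightarrow>
     f holomorphic_on upper_half_plane \<and> f ` upper_half_plane \<subseteq> upper_half_plane"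

definition non_elliptic :: "(complex \<Rightarrow> complex) \<Rightarrow> bool" where
  "non_elliptic f \<longleftrightarrow>
     holomorphic_self_map f \<and> (\<forall>z\<in>upper_half_plane. f z \<noteq> z)"

text \<open>Convergence of the iterates to the point at infinity of the Riemann sphere, uniformly
  on compact subsets, means that their moduli eventually exceed every bound uniformly.\<close>

definition denjoy_wolff_at_infinity :: "(complex \<Rightarrow> complex) \<Rightarrow> bool" where
  "denjoy_wolff_at_infinity f \<longleftrightarrow>
     non_elliptic f \<and>
     (\<forall>K. compact K \<and> K \<subseteq> upper_half_plane \<longrightarrow>
        (\<forall>R::real. \<forall>\<^sub>F n in sequentially. \<forall>z\<in>K. norm ((f ^^ n) z) > R))"

text \<open>The non-tangential approach regions at infinity are the sectors
  \<open>\<bar>x\<bar> \<le> M y\<close>, i.e. those bounded away in angle from the real axis.\<close>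

definition stolz_sector :: "real \<Rightarrow> complex set" where
  "stolz_sector M = {z \<in> upper_half_plane. \<bar>Re z\<bar> \<le> M * Im z}"

definition has_angular_limit_at_infinity :: "(complex \<Rightarrow> complex) \<Rightarrow> complex \<Rightarrow> bool" where
  "has_angular_limit_at_infinity g l \<longleftrightarrow>
     (\<forall>M>0. (g \<longlongrightarrow> l) (inf at_infinity (principal (stolz_sector M))))"

definition parabolic_at_infinity :: "(complex \<Rightarrow> complex) \<Rightarrow> bool" where
  "parabolic_at_infinity f \<longleftrightarrow>
     denjoy_wolff_at_infinity f \<and> has_angular_limit_at_infinity (\<lambda>z. f z / z) 1"

definition finite_shift :: "(complex \<Rightarrow> complex) \<Rightarrow> bool" where
  "finite_shift f \<longleftrightarrow>
     parabolic_at_infinity f \<and>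
     (\<exists>z0\<in>upper_half_plane. bdd_above (range (\<lambda>n. Im ((f ^^ n) z0))))"

end

theory Submission
  imports Defs
begin

text \<open>Write \<open>c = \<beta> - \<integral>t \<partial>\<mu>\<close>. Because \<open>(1 + t z) / (t - z) = (1 + t\<^sup>2) / (t - z) - t\<close>, the map moves a point \<open>z\<close>
  by \<open>c\<close> plus the Cauchy transform \<open>\<integral>(1 + t\<^sup>2) / (t - z) \<partial>\<mu>\<close>, provided that \<open>t\<close> is integrable. So it is
  enough to show that \<open>t\<close> is integrable and that the Cauchy transform tends to \<open>0\<close> along one orbit
  \<open>z\<^sub>n\<close>: then the increments of the orbit tend to \<open>c\<close>, hence so do their averages \<open>z\<^sub>n / n\<close>, up to a
  vanishing term. Any other orbit stays at bounded distance from \<open>z\<^sub>n\<close>, with a bound that is uniform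
  over a compact set of starting points, so it has the same asymptotic speed.

  Both facts about the orbit come from one estimate. Taking imaginary parts,
  \<open>Im z\<^sub>n\<^sub>+\<^sub>1 - Im z\<^sub>n = Im z\<^sub>n \<cdot> \<integral>P(t, z\<^sub>n) \<partial>\<mu>\<close> with the Poisson weight \<open>P(t, z) = (1 + t\<^sup>2) / \<bar>t - z\<bar>\<^sup>2\<close>. As the
  heights \<open>Im z\<^sub>n\<close> increase and are bounded, \<open>\<integral>\<Sum>\<^sub>n P(t, z\<^sub>n) \<partial>\<mu>\<close> is finite (\<open>sum_poisson_integral_le\<close>). By
  the Schwarz--Pick inequality the steps of the orbit have bounded Euclidean length, and since the
  orbit escapes to infinity at bounded height, its real parts go to infinity in one direction, say
  to the right. An orbit that goes to \<open>+\<infinity>\<close> with bounded steps passes within bounded distance of every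
  \<open>t \<ge> 0\<close>, and comes within distance of order \<open>\<bar>t\<bar>\<close> of \<open>t < 0\<close> at least \<open>\<bar>t\<bar>\<close> times. Hence \<open>\<Sum>\<^sub>n P(t, z\<^sub>n)\<close>
  dominates a multiple of \<open>1 + t\<^sup>2\<close> on the right and of \<open>(1 + t\<^sup>2) / (1 + \<bar>t\<bar>)\<close> on the left
  (\<open>sum_poisson_weight_ge\<close>), and this weight is integrable. Up to constants it dominates
  \<open>\<bar>t\<bar>\<close> and the integrand of the Cauchy transform along the orbit, so dominated convergence applies
  (\<open>cauchy_transform_tendsto_0\<close>).

  The Schwarz--Pick inequality is read off the integral representation, as a Cauchy--Schwarz
  inequality for the difference quotient of the kernel.\<close>

section \<open>The Nevanlinna kernel\<close>

definition nevanlinna_kernel :: "real \<Rightarrow> complex \<Rightarrow> complex" where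
  "nevanlinna_kernel t z = (1 + of_real t * z) / (of_real t - z)"

definition poisson_weight :: "real \<Rightarrow> complex \<Rightarrow> real" where
  "poisson_weight t z = (1 + t\<^sup>2) / (norm (of_real t - z))\<^sup>2"

lemma of_real_neq_upper: "0 < Im z \<Longrightarrow> complex_of_real t - z \<noteq> 0"
  by auto

lemma Im_le_norm_of_real_diff: "Im z \<le> norm (complex_of_real t - z)"
  using abs_Im_le_cmod[of "complex_of_real t - z"] by simp

lemma poisson_weight_nonneg: "0 \<le> poisson_weight t z"
  by (simp add: poisson_weight_def)

text \<open>This form shows that the kernel is bounded in \<open>t\<close>, hence integrable for every finite measure.\<close>

lemma nevanlinna_kernel_eq_bounded:
  assumes "0 < Im z"
  shows "nevanlinna_kernel t z = z + (1 + z\<^sup>2) / (of_real t - z)"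
  using of_real_neq_upper[OF assms, of t]
  by (simp add: nevanlinna_kernel_def field_simps power2_eq_square)

text \<open>This form separates the drift \<open>-t\<close> from the Cauchy kernel of the measure \<open>(1 + t\<^sup>2) \<partial>\<mu>\<close>, which may
  be infinite.\<close>

lemma nevanlinna_kernel_eq_cauchy:
  assumes "0 < Im z"
  shows "nevanlinna_kernel t z = of_real (1 + t\<^sup>2) / (of_real t - z) - of_real t"
  using of_real_neq_upper[OF assms, of t]
  by (simp add: nevanlinna_kernel_def field_simps power2_eq_square)

lemma Im_nevanlinna_kernel:
  assumes "0 < Im z"
  shows "Im (nevanlinna_kernel t z) = Im z * poisson_weight t z"
  using of_real_neq_upper[OF assms, of t]
  unfolding nevanlinna_kernel_eq_cauchy[OF assms]
  by (simp add: poisson_weight_def Im_divide cmod_power2)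

text \<open>The difference quotient of the kernel is \<open>(1 + t\<^sup>2) / ((t - z) (t - w))\<close>, whose modulus is the
  geometric mean of the two Poisson weights. The weighted arithmetic mean that bounds it is linear in
  the weights and so can be integrated; choosing \<open>s\<close> after the integration recovers the
  Cauchy--Schwarz inequality.\<close>

lemma norm_nevanlinna_kernel_diff_le:
  assumes "0 < Im z" "0 < Im w" "0 < s"
  shows "norm (nevanlinna_kernel t z - nevanlinna_kernel t w)
          \<le> norm (z - w) * ((s * poisson_weight t z + poisson_weight t w / s) / 2)"
proof -
  define a where "a = 1 / norm (complex_of_real t - z)"
  define b where "b = 1 / norm (complex_of_real t - w)"
  have "nevanlinna_kernel t z - nevanlinna_kernel t w
      = (z - w) * (of_real (1 + t\<^sup>2) / ((of_real t - z) * (of_real t - w)))"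
    unfolding nevanlinna_kernel_eq_cauchy[OF assms(1)] nevanlinna_kernel_eq_cauchy[OF assms(2)]
    using of_real_neq_upper[OF assms(1), of t] of_real_neq_upper[OF assms(2), of t]
    by (simp add: divide_simps) (simp add: algebra_simps)
  moreover have "norm (complex_of_real (1 + t\<^sup>2)) = 1 + t\<^sup>2"
    by (simp only: norm_of_real) simp
  ultimately have eq: "norm (nevanlinna_kernel t z - nevanlinna_kernel t w)
      = norm (z - w) * ((1 + t\<^sup>2) * (a * b))"
    by (simp only: norm_mult norm_divide) (simp add: a_def b_def)
  have "0 \<le> (s * a - b)\<^sup>2 / (2 * s)"
    using assms by simp
  also have "\<dots> = (s * a\<^sup>2 + b\<^sup>2 / s) / 2 - a * b"
    using assms by (simp add: field_simps power2_eq_square)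
  finally have "(1 + t\<^sup>2) * (a * b) \<le> (1 + t\<^sup>2) * ((s * a\<^sup>2 + b\<^sup>2 / s) / 2)"
    by (intro mult_left_mono) auto
  also have "\<dots> = (s * poisson_weight t z + poisson_weight t w / s) / 2"
    by (simp add: a_def b_def poisson_weight_def field_simps)
  finally show ?thesis
    unfolding eq by (intro mult_left_mono) auto
qed

section \<open>Sequences with controlled increments\<close>

lemma tendsto_over_n_of_increments:
  fixes a :: "nat \<Rightarrow> complex"
  assumes "(\<lambda>n. a (Suc n) - a n) \<longlonglongrightarrow> c"
  shows "(\<lambda>n. a n / of_nat n) \<longlonglongrightarrow> c"
proof (rule LIMSEQ_I)
  fix e :: real assume e: "0 < e"
  then obtain N where N: "\<And>n. n \<ge> N \<Longrightarrow> norm (a (Suc n) - a n - c) < e / 2"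
    using LIMSEQ_D[OF assms, of "e / 2"] by auto
  define d where "d n = a n - of_nat n * c" for n
  have d_Suc: "norm (d (Suc n) - d n) \<le> e / 2" if "n \<ge> N" for n
    using N[OF that] by (simp add: d_def algebra_simps)
  have d_le: "norm (d n) \<le> norm (d N) + real n * (e / 2)" if "n \<ge> N" for n
    using that
  proof (induction n rule: dec_induct)
    case (step n)
    have "norm (d (Suc n)) \<le> norm (d n) + norm (d (Suc n) - d n)"
      by (metis add.commute diff_add_cancel norm_triangle_ineq)
    then show ?case using step.IH d_Suc[OF step.hyps(1)] by (simp add: distrib_right add_divide_distrib)
  qed (use e in simp)
  obtain N' :: nat where N': "2 * norm (d N) / e < real N'"
    using reals_Archimedean2 by blast
  have "norm (a n / of_nat n - c) < e" if n: "n \<ge> max (Suc N) N'" for n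
  proof -
    have n0: "0 < real n" and "real N' \<le> real n" using n by auto
    then have "2 * norm (d N) / e < real n" using N' by linarith
    then have "norm (d N) < real n * (e / 2)" using e by (simp add: field_simps)
    moreover have "norm (d n) \<le> norm (d N) + real n * (e / 2)" using n by (intro d_le) auto
    ultimately have "norm (d n) < real n * e" by (simp add: field_simps)
    moreover have "a n / of_nat n - c = d n / of_nat n" using n0 by (simp add: d_def field_simps)
    ultimately show ?thesis using n0 by (simp add: norm_divide divide_less_eq mult.commute)
  qed
  then show "\<exists>no. \<forall>n\<ge>no. norm (a n / of_nat n - c) < e" by blast
qed

text \<open>Beyond the threshold \<open>\<bar>B\<bar> + 1\<close> a step of length at most \<open>B\<close> cannot change the sign.\<close>

lemma escape_in_one_direction:
  fixes x :: "nat \<Rightarrow> real"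
  assumes step: "\<And>n. \<bar>x (Suc n) - x n\<bar> \<le> B"
    and infty: "filterlim (\<lambda>n. \<bar>x n\<bar>) at_top sequentially"
  obtains s where "\<bar>s\<bar> = 1" "filterlim (\<lambda>n. s * x n) at_top sequentially"
proof -
  have "\<forall>\<^sub>F n in sequentially. \<bar>B\<bar> + 1 \<le> \<bar>x n\<bar>"
    using infty unfolding filterlim_at_top by blast
  then obtain N where N: "\<And>n. n \<ge> N \<Longrightarrow> \<bar>B\<bar> + 1 \<le> \<bar>x n\<bar>"
    unfolding eventually_sequentially by blast
  define s where "s = sgn (x N)"
  have "x N \<noteq> 0" using N[of N] by auto
  then have s1: "\<bar>s\<bar> = 1" by (auto simp: s_def sgn_if)
  have same: "s * x n = \<bar>x n\<bar>" if "n \<ge> N" for n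
    using that
  proof (induction n rule: dec_induct)
    case base
    then show ?case by (simp add: s_def sgn_if)
  next
    case (step n)
    have large: "\<bar>B\<bar> + 1 \<le> \<bar>x n\<bar>" "\<bar>B\<bar> + 1 \<le> \<bar>x (Suc n)\<bar>" "\<bar>x (Suc n) - x n\<bar> \<le> B"
      using N[of n] N[of "Suc n"] step.hyps assms(1)[of n] by simp_all
    consider "s = 1" | "s = -1" using s1 by linarith
    then show ?case
    proof cases
      case 1
      then have "x n = \<bar>x n\<bar>" using step.IH by simp
      then have "x (Suc n) = \<bar>x (Suc n)\<bar>" using large by linarith
      then show ?thesis using 1 by simp
    next
      case 2
      then have "- x n = \<bar>x n\<bar>" using step.IH by (simp only: mult_minus1)
      then have "- x (Suc n) = \<bar>x (Suc n)\<bar>" using large by linarith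
      then show ?thesis unfolding 2 by (simp only: mult_minus1)
    qed
  qed
  have "filterlim (\<lambda>n. s * x n) at_top sequentially"
    using infty
  proof (rule filterlim_at_top_mono)
    show "\<forall>\<^sub>F n in sequentially. \<bar>x n\<bar> \<le> s * x n"
      using eventually_ge_at_top[of N] by eventually_elim (simp add: same)
  qed
  with s1 show ?thesis by (rule that)
qed

section \<open>Poisson weights along an orbit that escapes to one side\<close>

text \<open>Up to a constant factor, a lower bound for the Poisson weights summed along an orbit that escapes in the direction
  of the sign \<open>s\<close>: the first case is the side to which the orbit goes.\<close>

definition one_sided_weight :: "real \<Rightarrow> real \<Rightarrow> real" where
  "one_sided_weight s t = (1 + t\<^sup>2) * (if 0 \<le> s * t then 1 else 1 / (1 + \<bar>t\<bar>))"

lemma borel_measurable_one_sided_weight [measurable]: "one_sided_weight s \<in> borel_measurable borel"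
  unfolding one_sided_weight_def [abs_def] by measurable

lemma one_sided_weight_nonneg: "0 \<le> one_sided_weight s t"
  by (simp add: one_sided_weight_def)

lemma abs_le_one_sided_weight: "\<bar>t\<bar> \<le> 2 * one_sided_weight s t"
proof -
  have sq: "0 \<le> (\<bar>t\<bar> - 1)\<^sup>2" by simp
  then have "\<bar>t\<bar> * (1 + \<bar>t\<bar>) \<le> 2 * (1 + t\<^sup>2)" by (simp add: power2_eq_square algebra_simps)
  then have "\<bar>t\<bar> \<le> 2 * (1 + t\<^sup>2) / (1 + \<bar>t\<bar>)" by (subst pos_le_divide_eq) auto
  moreover have "\<bar>t\<bar> \<le> 2 * (1 + t\<^sup>2)" using sq by (simp add: power2_eq_square algebra_simps)
  ultimately show ?thesis by (simp add: one_sided_weight_def)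
qed

lemma poisson_weight_ge:
  assumes "0 < Im z" "norm (of_real t - z) \<le> r"
  shows "(1 + t\<^sup>2) / r\<^sup>2 \<le> poisson_weight t z"
proof -
  have "0 < norm (of_real t - z)" using assms(1) of_real_neq_upper by simp
  then show ?thesis
    unfolding poisson_weight_def using assms(2) less_le_trans[OF _ assms(2), of 0]
    by (intro divide_left_mono power_mono mult_pos_pos zero_less_power) auto
qed

text \<open>On the side to which the orbit escapes, a single term suffices: the orbit jumps over \<open>t\<close> with a step
  of length at most \<open>B\<close>, so some \<open>z n\<close> is close to \<open>t\<close>. On the other side, \<open>z n\<close> is still at distance
  of order \<open>1 + \<bar>t\<bar>\<close> from \<open>t\<close> for all \<open>n\<close> up to \<open>\<bar>t\<bar>\<close>, and these \<open>1 + \<bar>t\<bar>\<close> terms of size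
  \<open>(1 + t\<^sup>2) / (1 + \<bar>t\<bar>)\<^sup>2\<close> are added.\<close>

lemma sum_poisson_weight_ge:
  fixes z :: "nat \<Rightarrow> complex"
  assumes s: "\<bar>s\<bar> = 1"
    and Im_pos: "\<And>n. 0 < Im (z n)" and Im_le: "\<And>n. Im (z n) \<le> Y"
    and step: "\<And>n. norm (z (Suc n) - z n) \<le> B"
    and infty: "filterlim (\<lambda>n. s * Re (z n)) at_top sequentially"
  obtains \<kappa> where "0 < \<kappa>" "\<And>t. \<exists>N. \<kappa> * one_sided_weight s t \<le> (\<Sum>n<N. poisson_weight t (z n))"
proof -
  define r where "r = 1 + norm (z 0) + Y + B"
  have Y: "0 < Y" using Im_pos[of 0] Im_le[of 0] by linarith
  have B: "0 \<le> B" using step[of 0] norm_ge_zero[of "z (Suc 0) - z 0"] by linarith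
  have r: "1 \<le> r" using Y B by (simp add: r_def)
  have "\<exists>N. 1 / r\<^sup>2 * one_sided_weight s t \<le> (\<Sum>n<N. poisson_weight t (z n))" for t
  proof (cases "0 \<le> s * t")
    case True
    have "\<exists>n. \<bar>s * t - s * Re (z n)\<bar> \<le> norm (z 0) + B"
    proof (cases "s * t \<le> s * Re (z 0)")
      case le: True
      have "\<bar>s * Re (z 0)\<bar> \<le> norm (z 0)" using s abs_Re_le_cmod by (simp add: abs_mult)
      then have "\<bar>s * t - s * Re (z 0)\<bar> \<le> norm (z 0) + B" using le True B by linarith
      then show ?thesis by blast
    next
      case False
      have "\<forall>\<^sub>F n in sequentially. s * t < s * Re (z n)"
        using infty by (simp add: filterlim_at_top_dense)
      then have ex: "\<exists>n. s * t < s * Re (z n)"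
        unfolding eventually_sequentially by blast
      \<comment> \<open>the first point of the orbit beyond \<open>t\<close>\<close>
      define n where "n = (LEAST n. s * t < s * Re (z n))"
      have n: "s * t < s * Re (z n)" unfolding n_def using ex by (rule LeastI_ex)
      with False obtain m where m: "n = Suc m" by (cases n) auto
      have "\<not> s * t < s * Re (z m)" using m not_less_Least[of m "\<lambda>n. s * t < s * Re (z n)"] unfolding n_def by simp
      moreover have "\<bar>s * Re (z n) - s * Re (z m)\<bar> \<le> B"
        using order_trans[OF abs_Re_le_cmod step[of m]] s m
        by (simp add: abs_mult flip: right_diff_distrib)
      ultimately have "\<bar>s * t - s * Re (z n)\<bar> \<le> norm (z 0) + B"
        using n norm_ge_zero[of "z 0"] by linarith
      then show ?thesis by blast
    qed
    then obtain n where "\<bar>s * t - s * Re (z n)\<bar> \<le> norm (z 0) + B" ..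
    then have "\<bar>t - Re (z n)\<bar> \<le> norm (z 0) + B"
      using s by (simp add: abs_mult flip: right_diff_distrib)
    then have "norm (of_real t - z n) \<le> r"
      using cmod_le[of "of_real t - z n"] Im_pos[of n] Im_le[of n] by (simp add: r_def)
    then have "(1 + t\<^sup>2) / r\<^sup>2 \<le> poisson_weight t (z n)"
      by (rule poisson_weight_ge[OF Im_pos])
    also have "\<dots> \<le> (\<Sum>n<Suc n. poisson_weight t (z n))"
      by (rule member_le_sum) (auto simp: poisson_weight_nonneg)
    finally have "1 / r\<^sup>2 * one_sided_weight s t \<le> (\<Sum>n<Suc n. poisson_weight t (z n))"
      using True by (simp add: one_sided_weight_def)
    then show ?thesis by blast
  next
    case False
    define N where "N = nat \<lceil>\<bar>t\<bar>\<rceil> + 1"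
    have N: "1 + \<bar>t\<bar> \<le> real N" "real N \<le> \<bar>t\<bar> + 2" unfolding N_def by linarith+
    have dist: "norm (z n) \<le> norm (z 0) + real n * B" for n
    proof (induction n)
      case (Suc n)
      have "norm (z (Suc n)) \<le> norm (z n) + norm (z (Suc n) - z n)"
        by (metis add.commute diff_add_cancel norm_triangle_ineq)
      then show ?case using Suc step[of n] by (simp add: distrib_right)
    qed simp
    have r_split: "r * (1 + \<bar>t\<bar>) = 1 + norm (z 0) + Y + B + \<bar>t\<bar> + \<bar>t\<bar> * norm (z 0) + \<bar>t\<bar> * Y + \<bar>t\<bar> * B"
      by (simp add: r_def algebra_simps)
    have ge: "(1 + t\<^sup>2) / (r * (1 + \<bar>t\<bar>))\<^sup>2 \<le> poisson_weight t (z n)" if "n < N" for n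
    proof (rule poisson_weight_ge[OF Im_pos])
      have "real n \<le> 1 + \<bar>t\<bar>" using that N by linarith
      then have "real n * B \<le> (1 + \<bar>t\<bar>) * B" using B by (rule mult_right_mono)
      then have "real n * B \<le> B + \<bar>t\<bar> * B" by (simp only: distrib_right mult_1)
      moreover have "0 \<le> \<bar>t\<bar> * norm (z 0)" "0 \<le> \<bar>t\<bar> * Y"
        using Y by auto
      moreover have "norm (of_real t - z n) \<le> \<bar>t\<bar> + norm (z n)"
        using norm_triangle_ineq4[of "of_real t" "z n"] by simp
      ultimately show "norm (of_real t - z n) \<le> r * (1 + \<bar>t\<bar>)"
        using dist[of n] Y unfolding r_split by linarith
    qed
    have "1 / r\<^sup>2 * one_sided_weight s t = (1 + \<bar>t\<bar>) * ((1 + t\<^sup>2) / (r * (1 + \<bar>t\<bar>))\<^sup>2)"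
      using False r by (simp add: one_sided_weight_def power_mult_distrib power2_eq_square)
    also have "\<dots> \<le> real N * ((1 + t\<^sup>2) / (r * (1 + \<bar>t\<bar>))\<^sup>2)"
      using N(1) by (rule mult_right_mono) simp
    also have "\<dots> \<le> (\<Sum>n<N. poisson_weight t (z n))"
      using sum_bounded_below[of "{..<N}" "(1 + t\<^sup>2) / (r * (1 + \<bar>t\<bar>))\<^sup>2" "\<lambda>n. poisson_weight t (z n)"] ge
      by simp
    finally show ?thesis by blast
  qed
  moreover have "0 < 1 / r\<^sup>2" using r by simp
  ultimately show ?thesis by (rule that[rotated])
qed

text \<open>The integrand tends to \<open>0\<close> pointwise, since \<open>z n\<close> escapes. For a dominating function, use
  \<open>\<bar>t - z n\<bar> \<ge> y\<close> on the side to which the orbit goes; on the other side, as soon as \<open>Re (z n)\<close> has the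
  sign \<open>s\<close>, also \<open>\<bar>t - z n\<bar> \<ge> \<bar>t\<bar>\<close>.\<close>

lemma cauchy_transform_tendsto_0:
  fixes z :: "nat \<Rightarrow> complex"
  assumes \<mu>: "sets \<mu> = sets borel" and W: "integrable \<mu> (one_sided_weight s)" and s: "\<bar>s\<bar> = 1"
    and y: "0 < y" "\<And>n. y \<le> Im (z n)"
    and infty: "filterlim (\<lambda>n. s * Re (z n)) at_top sequentially"
  shows "(\<lambda>n. \<integral>t. of_real (1 + t\<^sup>2) / (of_real t - z n) \<partial>\<mu>) \<longlonglongrightarrow> 0"
proof -
  note [measurable_cong] = \<mu>
  have Re_le: "s * Re (z n) - s * t \<le> norm (of_real t - z n)" for n t
  proof -
    have "s * Re (z n) - s * t \<le> \<bar>s * (Re (z n) - t)\<bar>" by (simp add: right_diff_distrib)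
    also have "\<dots> = \<bar>Re (of_real t - z n)\<bar>" using s by (simp add: abs_mult abs_minus_commute)
    also have "\<dots> \<le> norm (of_real t - z n)" by (rule abs_Re_le_cmod)
    finally show ?thesis .
  qed
  have "\<forall>\<^sub>F n in sequentially. 0 \<le> s * Re (z n)"
    using infty unfolding filterlim_at_top by blast
  then obtain N where N: "\<And>n. n \<ge> N \<Longrightarrow> 0 \<le> s * Re (z n)"
    unfolding eventually_sequentially by blast
  have "(\<lambda>n. \<integral>t. of_real (1 + t\<^sup>2) / (of_real t - z (n + N)) \<partial>\<mu>) \<longlonglongrightarrow> (\<integral>t. 0 \<partial>\<mu>)"
  proof (rule integral_dominated_convergence)
    show "integrable \<mu> (\<lambda>t. (1 + 1 / y) * one_sided_weight s t)"
      using W by simp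
    show "AE t in \<mu>. (\<lambda>n. of_real (1 + t\<^sup>2) / (of_real t - z (n + N))) \<longlonglongrightarrow> 0"
    proof (rule AE_I2, rule LIMSEQ_ignore_initial_segment, rule tendsto_divide_0[OF tendsto_const],
        rule filterlim_norm_at_top_imp_at_infinity)
      fix t
      have "filterlim (\<lambda>n. - (s * t) + s * Re (z n)) at_top sequentially"
        by (rule filterlim_tendsto_add_at_top[OF tendsto_const infty])
      then show "filterlim (\<lambda>n. norm (of_real t - z n)) at_top sequentially"
      proof (rule filterlim_at_top_mono, intro always_eventually allI)
        show "- (s * t) + s * Re (z n) \<le> norm (of_real t - z n)" for n
          using Re_le[of n t] by linarith
      qed
    qed
    show "AE t in \<mu>. norm (of_real (1 + t\<^sup>2) / (of_real t - z (n + N))) \<le> (1 + 1 / y) * one_sided_weight s t"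
      for n
    proof (intro AE_I2)
      fix t
      define d where "d = norm (of_real t - z (n + N))"
      have d: "y \<le> d" using Im_le_norm_of_real_diff[of "z (n + N)" t] y(2)[of "n + N"] by (simp add: d_def)
      have "norm (complex_of_real (1 + t\<^sup>2)) = 1 + t\<^sup>2"
        by (simp only: norm_of_real) simp
      then have eq: "norm (of_real (1 + t\<^sup>2) / (of_real t - z (n + N))) = (1 + t\<^sup>2) / d"
        by (simp only: norm_divide d_def)
      have "1 / d \<le> (1 + 1 / y) * (if 0 \<le> s * t then 1 else 1 / (1 + \<bar>t\<bar>))"
      proof (cases "0 \<le> s * t")
        case True
        have "1 / d \<le> 1 / y" using y(1) d by (simp add: frac_le)
        then show ?thesis using True by simp
      next
        case False
        have "\<bar>t\<bar> = \<bar>s * t\<bar>" using s by (simp add: abs_mult)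
        then have "\<bar>t\<bar> \<le> d" using False Re_le[of "n + N" t] N[of "n + N"] by (simp add: d_def)
        moreover have "1 \<le> d / y" using d y(1) by simp
        ultimately have "1 + \<bar>t\<bar> \<le> (1 + 1 / y) * d" by (simp add: distrib_right)
        then have "1 / d \<le> (1 + 1 / y) / (1 + \<bar>t\<bar>)"
          using d y(1) by (simp add: pos_divide_le_eq pos_le_divide_eq)
        then show ?thesis using False by simp
      qed
      then have "(1 + t\<^sup>2) * (1 / d)
          \<le> (1 + t\<^sup>2) * ((1 + 1 / y) * (if 0 \<le> s * t then 1 else 1 / (1 + \<bar>t\<bar>)))"
        by (rule mult_left_mono) simp
      then show "norm (of_real (1 + t\<^sup>2) / (of_real t - z (n + N))) \<le> (1 + 1 / y) * one_sided_weight s t"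
        unfolding eq one_sided_weight_def by (simp add: mult_ac)
    qed
  qed simp_all
  then show ?thesis
    by (simp add: LIMSEQ_offset[where k = N])
qed

section \<open>Self-maps with a Nevanlinna representation\<close>

locale nevanlinna_self_map = finite_measure \<mu> for \<mu> :: "real measure" +
  fixes f :: "complex \<Rightarrow> complex" and \<beta> :: real
  assumes sets_eq_borel: "sets \<mu> = sets borel"
    and representation:
      "0 < Im z \<Longrightarrow> f z = z + of_real \<beta> + (\<integral>t. nevanlinna_kernel t z \<partial>\<mu>)"
begin

lemmas [measurable_cong] = sets_eq_borel

lemma integrable_nevanlinna_kernel:
  assumes "0 < Im z"
  shows "integrable \<mu> (\<lambda>t. nevanlinna_kernel t z)"
proof (rule integrable_const_bound)
  show "AE t in \<mu>. norm (nevanlinna_kernel t z) \<le> norm z + norm (1 + z\<^sup>2) / Im z"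
  proof (intro AE_I2)
    fix t
    have "norm (nevanlinna_kernel t z) \<le> norm z + norm ((1 + z\<^sup>2) / (of_real t - z))"
      unfolding nevanlinna_kernel_eq_bounded[OF assms] by (rule norm_triangle_ineq)
    also have "norm ((1 + z\<^sup>2) / (of_real t - z)) \<le> norm (1 + z\<^sup>2) / Im z"
      unfolding norm_divide using assms Im_le_norm_of_real_diff[of z t]
      by (intro divide_left_mono mult_pos_pos) auto
    finally show "norm (nevanlinna_kernel t z) \<le> norm z + norm (1 + z\<^sup>2) / Im z"
      by simp
  qed
qed (simp add: nevanlinna_kernel_def)

lemma integrable_poisson_weight:
  assumes "0 < Im z"
  shows "integrable \<mu> (\<lambda>t. poisson_weight t z)"
proof -
  have "integrable \<mu> (\<lambda>t. Im (nevanlinna_kernel t z) / Im z)"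
    using integrable_nevanlinna_kernel[OF assms] by auto
  then show ?thesis
    using assms by (simp add: Im_nevanlinna_kernel)
qed

definition poisson_integral :: "complex \<Rightarrow> real" where
  "poisson_integral z = (\<integral>t. poisson_weight t z \<partial>\<mu>)"

lemma poisson_integral_nonneg: "0 \<le> poisson_integral z"
  by (simp add: poisson_integral_def poisson_weight_nonneg)

lemma Im_map:
  assumes "0 < Im z"
  shows "Im (f z) = Im z * (1 + poisson_integral z)"
proof -
  have "Im (\<integral>t. nevanlinna_kernel t z \<partial>\<mu>) = (\<integral>t. Im (nevanlinna_kernel t z) \<partial>\<mu>)"
    using integrable_nevanlinna_kernel[OF assms] by simp
  then show ?thesis
    by (simp add: representation[OF assms] Im_nevanlinna_kernel[OF assms]
        poisson_integral_def distrib_left)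
qed

lemma Im_map_mono: "0 < Im z \<Longrightarrow> Im z \<le> Im (f z)"
  using poisson_integral_nonneg[of z] by (simp add: Im_map)

text \<open>The quotient \<open>\<bar>z - w\<bar>\<^sup>2 / (Im z Im w)\<close> is an increasing function of the hyperbolic distance. The two
  dilations \<open>Im (f z) / Im z\<close> and \<open>Im (f w) / Im w\<close> are \<open>1\<close> plus the integrals of the Poisson weights, and
  the difference quotient of \<open>f\<close> is \<open>1\<close> plus the integral of that of the kernel, so the inequality is the
  Cauchy--Schwarz inequality for \<open>\<mu>\<close> with one atom of mass \<open>1\<close> added.\<close>

lemma schwarz_pick:
  assumes z: "0 < Im z" and w: "0 < Im w"
  shows "(norm (f z - f w))\<^sup>2 / (Im (f z) * Im (f w)) \<le> (norm (z - w))\<^sup>2 / (Im z * Im w)"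
proof -
  define A where "A = 1 + poisson_integral z"
  define B where "B = 1 + poisson_integral w"
  \<comment> \<open>the parameter for which \<open>(s * A + B / s) / 2\<close> is the geometric mean of \<open>A\<close> and \<open>B\<close>\<close>
  define s where "s = sqrt (B / A)"
  have AB: "1 \<le> A" "1 \<le> B"
    using poisson_integral_nonneg by (auto simp: A_def B_def)
  then have s: "0 < s"
    by (simp add: s_def)
  have sA: "s * A = sqrt (A * B)" and sB: "B / s = sqrt (A * B)"
    using AB by (simp_all add: s_def real_sqrt_divide real_sqrt_mult field_simps)
  have "2 \<le> s + 1 / s"
  proof -
    have "0 \<le> (s - 1)\<^sup>2 / s" using s by simp
    also have "\<dots> = s + 1 / s - 2" using s by (simp add: field_simps power2_eq_square)
    finally show ?thesis by simp
  qed
  then have s2: "1 \<le> (s + 1 / s) / 2" by simp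
  have int: "integrable \<mu> (\<lambda>t. nevanlinna_kernel t z - nevanlinna_kernel t w)"
    using z w by (intro Bochner_Integration.integrable_diff integrable_nevanlinna_kernel)
  have intP: "integrable \<mu> (\<lambda>t. poisson_weight t z)" "integrable \<mu> (\<lambda>t. poisson_weight t w)"
    using z w by (auto intro: integrable_poisson_weight)
  have "norm (\<integral>t. nevanlinna_kernel t z - nevanlinna_kernel t w \<partial>\<mu>)
      \<le> (\<integral>t. norm (nevanlinna_kernel t z - nevanlinna_kernel t w) \<partial>\<mu>)"
    by (rule integral_norm_bound)
  also have "\<dots> \<le> (\<integral>t. norm (z - w) * ((s * poisson_weight t z + poisson_weight t w / s) / 2) \<partial>\<mu>)"
    using int intP norm_nevanlinna_kernel_diff_le[OF z w s]
    by (intro integral_mono) auto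
  also have "\<dots> = norm (z - w) * ((s * poisson_integral z + poisson_integral w / s) / 2)"
    using intP by (simp add: poisson_integral_def)
  finally have *: "norm (\<integral>t. nevanlinna_kernel t z - nevanlinna_kernel t w \<partial>\<mu>)
      \<le> norm (z - w) * ((s * poisson_integral z + poisson_integral w / s) / 2)" .
  have "f z - f w = (z - w) + (\<integral>t. nevanlinna_kernel t z - nevanlinna_kernel t w \<partial>\<mu>)"
    using z w by (simp add: representation integrable_nevanlinna_kernel)
  then have "norm (f z - f w)
      \<le> norm (z - w) + norm (z - w) * ((s * poisson_integral z + poisson_integral w / s) / 2)"
    using norm_triangle_ineq * by (metis add_left_mono order_trans)
  also have "\<dots> \<le> norm (z - w) * ((s + 1 / s) / 2) +
      norm (z - w) * ((s * poisson_integral z + poisson_integral w / s) / 2)"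
    using mult_left_mono[OF s2, of "norm (z - w)"] by simp
  also have "\<dots> = norm (z - w) * ((s * A + B / s) / 2)"
    by (simp add: A_def B_def algebra_simps add_divide_distrib)
  also have "\<dots> = norm (z - w) * sqrt (A * B)"
    by (simp add: sA sB)
  finally have "(norm (f z - f w))\<^sup>2 \<le> (norm (z - w) * sqrt (A * B))\<^sup>2"
    by (rule power_mono) simp
  also have "\<dots> = (norm (z - w))\<^sup>2 * (A * B)"
    using AB by (simp add: power_mult_distrib)
  finally have "(norm (f z - f w))\<^sup>2 / (Im (f z) * Im (f w))
      \<le> (norm (z - w))\<^sup>2 * (A * B) / (Im (f z) * Im (f w))"
    using z w Im_map_mono[OF z] Im_map_mono[OF w] by (intro divide_right_mono) auto
  also have "\<dots> = (norm (z - w))\<^sup>2 / (Im z * Im w)"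
    using AB z w by (simp add: Im_map A_def [symmetric] B_def [symmetric])
  finally show ?thesis .
qed

lemma Im_iterate_pos: "0 < Im z \<Longrightarrow> 0 < Im ((f ^^ n) z)"
  by (induction n) (use Im_map_mono in \<open>force+\<close>)

lemma Im_iterate_ge:
  assumes "0 < Im z"
  shows "Im z \<le> Im ((f ^^ n) z)"
proof (induction n)
  case (Suc n)
  then show ?case using Im_map_mono[OF Im_iterate_pos[OF assms, of n]] by simp
qed simp

lemma schwarz_pick_iterate:
  assumes "0 < Im z" "0 < Im w"
  shows "(norm ((f ^^ n) z - (f ^^ n) w))\<^sup>2 / (Im ((f ^^ n) z) * Im ((f ^^ n) w))
          \<le> (norm (z - w))\<^sup>2 / (Im z * Im w)"
proof (induction n)
  case (Suc n)
  have "(norm ((f ^^ Suc n) z - (f ^^ Suc n) w))\<^sup>2 / (Im ((f ^^ Suc n) z) * Im ((f ^^ Suc n) w))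
      \<le> (norm ((f ^^ n) z - (f ^^ n) w))\<^sup>2 / (Im ((f ^^ n) z) * Im ((f ^^ n) w))"
    using schwarz_pick[of "(f ^^ n) z" "(f ^^ n) w"] Im_iterate_pos assms by simp
  with Suc.IH show ?case by linarith
qed simp

text \<open>At bounded height, hyperbolic distance controls Euclidean distance. Only the height of the orbit of
  \<open>w\<close> is assumed bounded: if \<open>d\<close> is the distance of the orbits and \<open>d \<ge> Y\<close>, then the orbit of \<open>z\<close> has height
  at most \<open>Y + d \<le> 2 d\<close>, so that the Schwarz--Pick inequality gives \<open>d\<^sup>2 \<le> 2 M Y d\<close>.\<close>

lemma iterates_stay_close:
  assumes z: "0 < Im z" and w: "0 < Im w" and Y: "Im ((f ^^ n) w) \<le> Y"
    and M: "(norm (z - w))\<^sup>2 / (Im z * Im w) \<le> M"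
  shows "norm ((f ^^ n) z - (f ^^ n) w) \<le> Y + 2 * M * Y"
proof (rule ccontr)
  define d where "d = norm ((f ^^ n) z - (f ^^ n) w)"
  assume "\<not> norm ((f ^^ n) z - (f ^^ n) w) \<le> Y + 2 * M * Y"
  then have d: "Y + 2 * M * Y < d" by (simp add: d_def)
  have pos: "0 < Im ((f ^^ n) z)" "0 < Im ((f ^^ n) w)"
    using z w by (auto intro: Im_iterate_pos)
  then have Ypos: "0 < Y" using Y by linarith
  have "0 \<le> (norm (z - w))\<^sup>2 / (Im z * Im w)" using z w by simp
  then have M0: "0 \<le> M" using M by linarith
  have Yd: "Y \<le> d" using d M0 Ypos by (smt (verit) mult_nonneg_nonneg)
  have "d\<^sup>2 \<le> M * (Im ((f ^^ n) z) * Im ((f ^^ n) w))"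
    using order_trans[OF schwarz_pick_iterate[OF z w, of n] M] mult_pos_pos[OF pos]
    unfolding d_def by (simp only: pos_divide_le_eq)
  also have "\<dots> \<le> M * ((2 * d) * Y)"
  proof (intro mult_left_mono mult_mono M0)
    have "Im ((f ^^ n) z) - Im ((f ^^ n) w) \<le> d"
      unfolding d_def using abs_Im_le_cmod[of "(f ^^ n) z - (f ^^ n) w"] by simp
    then show "Im ((f ^^ n) z) \<le> 2 * d" using Y Yd by linarith
  qed (use pos Y Ypos Yd in auto)
  finally have "d * d \<le> (2 * M * Y) * d" by (simp add: power2_eq_square mult_ac)
  then have "d \<le> 2 * M * Y" using Yd Ypos by (simp add: mult_le_cancel_right)
  then show False using d Ypos by linarith
qed

text \<open>The height gained in a step is the height times the Poisson integral, and the gains telescope.\<close>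

lemma sum_poisson_integral_le:
  assumes z: "0 < Im z" and Y: "\<And>n. Im ((f ^^ n) z) \<le> Y"
  shows "(\<Sum>n<N. poisson_integral ((f ^^ n) z)) \<le> Y / Im z"
proof -
  have step: "Im z * poisson_integral ((f ^^ n) z) \<le> Im ((f ^^ Suc n) z) - Im ((f ^^ n) z)" for n
  proof -
    have "Im ((f ^^ Suc n) z) - Im ((f ^^ n) z) = Im ((f ^^ n) z) * poisson_integral ((f ^^ n) z)"
      using Im_map[OF Im_iterate_pos[OF z]] by (simp add: algebra_simps)
    then show ?thesis
      using Im_iterate_ge[OF z] poisson_integral_nonneg by (simp add: mult_right_mono)
  qed
  have "Im z * (\<Sum>n<N. poisson_integral ((f ^^ n) z)) \<le> (\<Sum>n<N. Im ((f ^^ Suc n) z) - Im ((f ^^ n) z))"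
    unfolding sum_distrib_left by (intro sum_mono step)
  also have "\<dots> = Im ((f ^^ N) z) - Im z"
    by (subst sum_lessThan_telescope) simp
  also have "\<dots> \<le> Y" using Y[of N] z by linarith
  finally show ?thesis using z by (simp add: pos_le_divide_eq mult.commute)
qed

section \<open>Orbits of bounded height\<close>

text \<open>Consecutive points of the orbit of \<open>z\<close> are points with equal index on the orbits of \<open>f z\<close> and \<open>z\<close>.\<close>

lemma bounded_orbit_steps:
  assumes "0 < Im z" "\<And>n. Im ((f ^^ n) z) \<le> Y"
  obtains B where "\<And>n. norm ((f ^^ Suc n) z - (f ^^ n) z) \<le> B"
proof
  have "0 < Im (f z)" using Im_map_mono[OF assms(1)] assms(1) by linarith
  then show "norm ((f ^^ Suc n) z - (f ^^ n) z)
      \<le> Y + 2 * ((norm (f z - z))\<^sup>2 / (Im (f z) * Im z)) * Y" for n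
    using iterates_stay_close[OF _ assms(1) assms(2) order_refl, of "f z" n]
    by (simp add: funpow_swap1)
qed

lemma bounded_orbit_direction:
  assumes z: "0 < Im z" and Y: "\<And>n. Im ((f ^^ n) z) \<le> Y"
    and infty: "filterlim (\<lambda>n. norm ((f ^^ n) z)) at_top sequentially"
  obtains s where "\<bar>s\<bar> = 1" "filterlim (\<lambda>n. s * Re ((f ^^ n) z)) at_top sequentially"
proof -
  obtain B where B: "\<And>n. norm ((f ^^ Suc n) z - (f ^^ n) z) \<le> B"
    using bounded_orbit_steps[OF z Y] by blast
  have "filterlim (\<lambda>n. - Y + norm ((f ^^ n) z)) at_top sequentially"
    by (rule filterlim_tendsto_add_at_top[OF tendsto_const infty])
  then have "filterlim (\<lambda>n. \<bar>Re ((f ^^ n) z)\<bar>) at_top sequentially"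
  proof (rule filterlim_at_top_mono, intro always_eventually allI)
    show "- Y + norm ((f ^^ n) z) \<le> \<bar>Re ((f ^^ n) z)\<bar>" for n
      using cmod_le[of "(f ^^ n) z"] Y[of n] Im_iterate_pos[OF z, of n] by linarith
  qed
  moreover have "\<bar>Re ((f ^^ Suc n) z) - Re ((f ^^ n) z)\<bar> \<le> B" for n
    using order_trans[OF abs_Re_le_cmod B[of n]] by simp
  ultimately show ?thesis
    using escape_in_one_direction[of "\<lambda>n. Re ((f ^^ n) z)" B] that by blast
qed

text \<open>The increasing heights are bounded, so the Poisson weights summed along the orbit have a finite
  integral; the one-sided weight lies below a multiple of that sum.\<close>

lemma integrable_one_sided_weight:
  assumes z: "0 < Im z" and Y: "\<And>n. Im ((f ^^ n) z) \<le> Y" and s: "\<bar>s\<bar> = 1"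
    and infty: "filterlim (\<lambda>n. s * Re ((f ^^ n) z)) at_top sequentially"
  shows "integrable \<mu> (one_sided_weight s)"
proof -
  note pos = Im_iterate_pos[OF z]
  obtain B where B: "\<And>n. norm ((f ^^ Suc n) z - (f ^^ n) z) \<le> B"
    using bounded_orbit_steps[OF z Y] by blast
  obtain \<kappa> where \<kappa>: "0 < \<kappa>"
    and ge: "\<And>t. \<exists>N. \<kappa> * one_sided_weight s t \<le> (\<Sum>n<N. poisson_weight t ((f ^^ n) z))"
    using sum_poisson_weight_ge[OF s pos Y B infty] by metis
  have meas [measurable]: "(\<lambda>t. poisson_weight t w) \<in> borel_measurable \<mu>" for w
    unfolding poisson_weight_def by measurable
  have "(\<integral>\<^sup>+t. ennreal (\<kappa> * one_sided_weight s t) \<partial>\<mu>)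
      \<le> (\<integral>\<^sup>+t. (\<Sum>n. ennreal (poisson_weight t ((f ^^ n) z))) \<partial>\<mu>)"
  proof (rule nn_integral_mono)
    fix t
    obtain N where "\<kappa> * one_sided_weight s t \<le> (\<Sum>n<N. poisson_weight t ((f ^^ n) z))"
      using ge by blast
    then have "ennreal (\<kappa> * one_sided_weight s t) \<le> (\<Sum>n<N. ennreal (poisson_weight t ((f ^^ n) z)))"
      by (simp add: poisson_weight_nonneg sum_ennreal ennreal_leI)
    also have "\<dots> \<le> (\<Sum>n. ennreal (poisson_weight t ((f ^^ n) z)))"
      by (rule sum_le_suminf) auto
    finally show "ennreal (\<kappa> * one_sided_weight s t) \<le> (\<Sum>n. ennreal (poisson_weight t ((f ^^ n) z)))" .
  qed
  also have "\<dots> = (\<Sum>n. \<integral>\<^sup>+t. ennreal (poisson_weight t ((f ^^ n) z)) \<partial>\<mu>)"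
    by (rule nn_integral_suminf) measurable
  also have "\<dots> = (\<Sum>n. ennreal (poisson_integral ((f ^^ n) z)))"
    by (simp add: poisson_integral_def nn_integral_eq_integral integrable_poisson_weight pos
        poisson_weight_nonneg)
  also have "\<dots> \<le> ennreal (Y / Im z)"
  proof (rule suminf_le_const)
    show "(\<Sum>n<N. ennreal (poisson_integral ((f ^^ n) z))) \<le> ennreal (Y / Im z)" for N
      using sum_poisson_integral_le[OF z Y] by (simp add: poisson_integral_nonneg sum_ennreal ennreal_leI)
  qed auto
  finally have "(\<integral>\<^sup>+t. ennreal (\<kappa> * one_sided_weight s t) \<partial>\<mu>) < \<infinity>"
    by (rule le_less_trans) simp
  then have "integrable \<mu> (\<lambda>t. \<kappa> * one_sided_weight s t)"
    using \<kappa> by (intro integrableI_nonneg) (auto simp: one_sided_weight_nonneg)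
  then show ?thesis using \<kappa> by simp
qed

text \<open>A multiple of the one-sided weight dominates \<open>\<bar>t\<bar>\<close>, so the kernel may be split under the integral; the remaining
  Cauchy transform vanishes along the orbit.\<close>

lemma orbit_increments_tendsto:
  assumes z: "0 < Im z" and Y: "\<And>n. Im ((f ^^ n) z) \<le> Y"
    and infty: "filterlim (\<lambda>n. norm ((f ^^ n) z)) at_top sequentially"
  shows "(\<lambda>n. (f ^^ Suc n) z - (f ^^ n) z) \<longlonglongrightarrow> of_real (\<beta> - (\<integral>t. t \<partial>\<mu>))"
proof -
  note pos = Im_iterate_pos[OF z]
  obtain s where s: "\<bar>s\<bar> = 1" and dir: "filterlim (\<lambda>n. s * Re ((f ^^ n) z)) at_top sequentially"
    using bounded_orbit_direction[OF z Y infty] .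
  have W: "integrable \<mu> (one_sided_weight s)"
    by (rule integrable_one_sided_weight[OF z Y s dir])
  have id: "integrable \<mu> (\<lambda>t. t)"
  proof (rule Bochner_Integration.integrable_bound)
    show "integrable \<mu> (\<lambda>t. 2 * one_sided_weight s t)" using W by simp
    show "AE t in \<mu>. norm t \<le> norm (2 * one_sided_weight s t)"
      using abs_le_one_sided_weight[of _ s] by (auto simp: one_sided_weight_nonneg)
  qed simp
  have eq: "(f ^^ Suc n) z - (f ^^ n) z = of_real (\<beta> - (\<integral>t. t \<partial>\<mu>))
      + (\<integral>t. of_real (1 + t\<^sup>2) / (of_real t - (f ^^ n) z) \<partial>\<mu>)" for n
  proof -
    have "integrable \<mu> (\<lambda>t. nevanlinna_kernel t ((f ^^ n) z) + of_real t)"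
      using integrable_nevanlinna_kernel[OF pos] id by auto
    then have "integrable \<mu> (\<lambda>t. of_real (1 + t\<^sup>2) / (of_real t - (f ^^ n) z))"
      by (simp add: nevanlinna_kernel_eq_cauchy[OF pos])
    then have "(\<integral>t. nevanlinna_kernel t ((f ^^ n) z) \<partial>\<mu>)
        = (\<integral>t. of_real (1 + t\<^sup>2) / (of_real t - (f ^^ n) z) \<partial>\<mu>) - of_real (\<integral>t. t \<partial>\<mu>)"
      unfolding nevanlinna_kernel_eq_cauchy[OF pos] using id by simp
    then show ?thesis using representation[OF pos[of n]] by simp
  qed
  have "(\<lambda>n. \<integral>t. of_real (1 + t\<^sup>2) / (of_real t - (f ^^ n) z) \<partial>\<mu>) \<longlonglongrightarrow> 0"
    by (rule cauchy_transform_tendsto_0[OF sets_eq_borel W s z Im_iterate_ge[OF z] dir])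
  from tendsto_add[OF tendsto_const this] show ?thesis
    unfolding eq by simp
qed

lemma uniform_limit_iterates_over_n:
  assumes z: "0 < Im z" and Y: "\<And>n. Im ((f ^^ n) z) \<le> Y"
    and infty: "filterlim (\<lambda>n. norm ((f ^^ n) z)) at_top sequentially"
    and K: "compact K" "\<And>w. w \<in> K \<Longrightarrow> 0 < Im w"
  shows "uniform_limit K (\<lambda>n w. (f ^^ n) w / of_nat n)
           (\<lambda>_. of_real (\<beta> - (\<integral>t. t \<partial>\<mu>))) sequentially"
proof -
  have "continuous_on K (\<lambda>w. (norm (w - z))\<^sup>2 / (Im w * Im z))"
    using z K(2) by (intro continuous_intros) force
  then have "bounded ((\<lambda>w. (norm (w - z))\<^sup>2 / (Im w * Im z)) ` K)"
    using K(1) by (intro compact_imp_bounded compact_continuous_image)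
  then obtain M where "\<And>w. w \<in> K \<Longrightarrow> norm ((norm (w - z))\<^sup>2 / (Im w * Im z)) \<le> M"
    by (auto simp: bounded_iff)
  then have M: "\<And>w. w \<in> K \<Longrightarrow> (norm (w - z))\<^sup>2 / (Im w * Im z) \<le> M"
    unfolding real_norm_def by (meson abs_le_D1)
  define C where "C = Y + 2 * M * Y"
  have close: "norm ((f ^^ n) w - (f ^^ n) z) \<le> C" if "w \<in> K" for n w
    unfolding C_def using iterates_stay_close[OF K(2)[OF that] z Y M[OF that]] .
  define c where "c = complex_of_real (\<beta> - (\<integral>t. t \<partial>\<mu>))"
  have "(\<lambda>n. (f ^^ n) z / of_nat n) \<longlonglongrightarrow> c"
    unfolding c_def by (intro tendsto_over_n_of_increments orbit_increments_tendsto[OF z Y infty])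
  then have "(\<lambda>n. norm ((f ^^ n) z / of_nat n - c)) \<longlonglongrightarrow> 0"
    by (simp add: LIM_zero tendsto_norm_zero)
  moreover have "(\<lambda>n. C / real n) \<longlonglongrightarrow> 0"
    by (rule lim_const_over_n)
  ultimately have lim: "(\<lambda>n. C / real n + norm ((f ^^ n) z / of_nat n - c)) \<longlonglongrightarrow> 0"
    using tendsto_add by fastforce
  show ?thesis
    unfolding c_def [symmetric]
  proof (rule uniform_limitI)
    fix e :: real assume "0 < e"
    with lim have "\<forall>\<^sub>F n in sequentially. C / real n + norm ((f ^^ n) z / of_nat n - c) < e"
      by (rule order_tendstoD)
    then show "\<forall>\<^sub>F n in sequentially. \<forall>w\<in>K. dist ((f ^^ n) w / of_nat n) c < e"
    proof (rule eventually_mono, intro ballI)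
      fix n w
      assume less: "C / real n + norm ((f ^^ n) z / of_nat n - c) < e" and "w \<in> K"
      have "(f ^^ n) w / of_nat n - c
          = ((f ^^ n) w - (f ^^ n) z) / of_nat n + ((f ^^ n) z / of_nat n - c)"
        by (simp add: diff_divide_distrib)
      then have "norm ((f ^^ n) w / of_nat n - c)
          \<le> norm (((f ^^ n) w - (f ^^ n) z) / of_nat n) + norm ((f ^^ n) z / of_nat n - c)"
        by (simp only: norm_triangle_ineq)
      also have "norm (((f ^^ n) w - (f ^^ n) z) / of_nat n) \<le> C / real n"
        using close[OF \<open>w \<in> K\<close>, of n] by (simp add: norm_divide divide_right_mono)
      finally show "dist ((f ^^ n) w / of_nat n) c < e"
        using less by (simp add: dist_norm)
    qed
  qed
qed

end

theorem corollary1p6: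
  fixes f :: "complex \<Rightarrow> complex" and \<beta> :: real and \<mu> :: "real measure"
  assumes "parabolic_at_infinity f"
    and "finite_shift f"
    and "finite_measure \<mu>" and "sets \<mu> = sets borel"
    and "\<And>z. z \<in> upper_half_plane \<Longrightarrow>
           f z = z + of_real \<beta> +
             (\<integral>t. (1 + of_real t * z) / (of_real t - z) \<partial>\<mu>)"
  shows "\<forall>K. compact K \<and> K \<subseteq> upper_half_plane \<longrightarrow>
           uniform_limit K (\<lambda>n z. (f ^^ n) z / of_nat n)
             (\<lambda>_. of_real (\<beta> - (\<integral>t. t \<partial>\<mu>))) sequentially"
proof -
  interpret finite_measure \<mu> by fact
  interpret nevanlinna_self_map \<mu> f \<beta>
    by unfold_locales (use assms(4,5) in \<open>auto simp: upper_half_plane_def nevanlinna_kernel_def\<close>)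
  obtain z Y where z: "0 < Im z" and Y: "\<And>n. Im ((f ^^ n) z) \<le> Y"
    using assms(2) by (auto simp: finite_shift_def upper_half_plane_def bdd_above_def)
  have "\<forall>\<^sub>F n in sequentially. \<forall>w\<in>{z}. R < norm ((f ^^ n) w)" for R
    using assms(1) z compact_sing[of z]
    unfolding parabolic_at_infinity_def denjoy_wolff_at_infinity_def upper_half_plane_def by blast
  then have "filterlim (\<lambda>n. norm ((f ^^ n) z)) at_top sequentially"
    by (simp add: filterlim_at_top_dense)
  then show ?thesis
    using uniform_limit_iterates_over_n[OF z Y] by (auto simp: upper_half_plane_def)
qed

end
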